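(* Let $\lambda \in \mathbb{C}$, $\lambda \neq 0$, and let $F$ be a finite subset of the set of poles $S = S(\lambda)$ satisfying $$\max\{ |a| : a \in F \} < \min\{ |a| : a \in S \setminus F \} =: \mu .$$ Let $K \subset \mathbb{C}$ be compact. Then for all integers $n \geq 2$, uniformly for $z \in K$, $$\frac{\mathcal{B}_{n}(z;\lambda)}{n!} = -\sum_{a \in F} \frac{e^{az}}{a^{n}} + O\left(\frac{e^{\mu|z|}}{\mu^{n}}\right),$$ where the constant implicit in the order term depends only on $\lambda$, $F$ and $K$; that is, there is a constant $C = C(\lambda,F,K)$ such that $$\left|\frac{\mathcal{B}_{n}(z;\lambda)}{n!} + \sum_{a \in F} \frac{e^{az}}{a^{n}}\right| \le C\,\frac{e^{\mu|z|}}{\mu^{n}} \qquad \text{for all } n \ge 2,\ z \in K.$$ Moreover, for $n$ sufficiently large (how large depending on $K$), the order constant may be taken equal to the value of the constant for $z=0$, thus eliminating its dependence on $K$: if $c = c(\lambda,F)$ is a constant such that $\left|\frac{\mathcal{B}_{n}(0;\lambda)}{n!} + \sum_{a \in F} a^{-n}\right| \le c\,\mu^{-n}$ for all $n \ge 2$, then there is $N$ (depending on $\lambda, F, K, c$) such that the displayed inequality holds with $C=c$ for all $n \ge N$ and all $z \in K$.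
   Context: The Apostol-Bernoulli polynomials $\mathcal{B}_n(x;\lambda)$ ($n\ge 0$, parameter $\lambda\in\mathbb{C}$) are defined by the power series expansion at $z=0$ $$\frac{z e^{xz}}{\lambda e^z-1} = \sum_{n=0}^\infty \mathcal{B}_n(x;\lambda)\, \frac{z^n}{n!}$$ (for $\lambda=1$ the singularity at $z=0$ is removable). $\log$ denotes the principal branch, $\log\lambda = \log|\lambda| + i\arg\lambda$ with $-\pi<\arg\lambda\le\pi$. For $\lambda \neq 0$, the set of poles of this generating function (as a function of $z$) is $S = \{2\pi i k - \log\lambda : k \in \mathbb{Z}\}$ if $\lambda\ne 1$, and $S = \{2\pi i k : k \in \mathbb{Z}, k\neq 0\}$ if $\lambda = 1$. *)

theory Defs
  imports "HOL-Complex_Analysis.Complex_Analysis"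
begin

definition apostol_bernoulli_gen :: "complex \<Rightarrow> complex \<Rightarrow> complex \<Rightarrow> complex" where
  "apostol_bernoulli_gen x l z = z * exp (x * z) / (l * exp z - 1)"

(* For l = 1 the quotient evaluates to 0 at z = 0 because x / 0 = 0;
   remove_sings puts the limit value 1 there. *)
definition apostol_bernoulli :: "nat \<Rightarrow> complex \<Rightarrow> complex \<Rightarrow> complex" where
  "apostol_bernoulli n x l =
     fact n * fps_nth (fps_expansion (remove_sings (apostol_bernoulli_gen x l)) 0) n"

(* Only meaningful for l \<noteq> 0; Ln is the principal branch, with Im (Ln l) in (-pi, pi]. *)
definition apostol_bernoulli_poles :: "complex \<Rightarrow> complex set" where
  "apostol_bernoulli_poles l =
     (if l = 1 then {2 * of_real pi * \<i> * of_int k | k :: int. k \<noteq> 0}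
      else {2 * of_real pi * \<i> * of_int k - Ln l | k :: int. True})"

lemma apostol_bernoulli_gen_isolated: "isolated_singularity_at (apostol_bernoulli_gen x l) 0"
  unfolding apostol_bernoulli_gen_def
  by (intro isolated_singularity_at_divide not_essential_analytic isolated_singularity_at_analytic
      analytic_intros)

lemma apostol_bernoulli_gen_tendsto:
  "apostol_bernoulli_gen x l \<midarrow>0\<rightarrow> (if l = 1 then 1 else 0)"
proof (cases "l = 1")
  case False
  then have "apostol_bernoulli_gen x l \<midarrow>0\<rightarrow> 0"
    unfolding apostol_bernoulli_gen_def by (auto intro!: tendsto_eq_intros)
  then show ?thesis using False by simp
next
  case True
  have "(\<lambda>z::complex. (exp z - 1) / z) \<midarrow>0\<rightarrow> 1"
    using DERIV_exp[of "0::complex"] by (simp add: DERIV_def)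
  then have "(\<lambda>z. exp (x * z) / ((exp z - 1) / z)) \<midarrow>0\<rightarrow> exp (x * 0) / 1"
    by (intro tendsto_intros) auto
  then have "apostol_bernoulli_gen x l \<midarrow>0\<rightarrow> 1"
    unfolding apostol_bernoulli_gen_def True by (simp add: mult.commute)
  then show ?thesis using True by simp
qed

lemma apostol_bernoulli_gen_has_fps_expansion:
  "remove_sings (apostol_bernoulli_gen x l) has_fps_expansion
     Abs_fps (\<lambda>n. apostol_bernoulli n x l / fact n)"
  using analytic_at_imp_has_fps_expansion_0[OF remove_sings_analytic_at
      [OF apostol_bernoulli_gen_isolated apostol_bernoulli_gen_tendsto]]
  by (simp add: apostol_bernoulli_def fps_nth_inverse)

lemma exp_eq_inverse_iff_poles:
  assumes "l \<noteq> 0"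
  shows "l * exp z = 1 \<and> (l = 1 \<longrightarrow> z \<noteq> 0) \<longleftrightarrow> z \<in> apostol_bernoulli_poles l"
proof -
  have "l * exp z = 1 \<longleftrightarrow> exp (z + Ln l) = 1"
    using assms by (simp add: exp_add mult.commute)
  also have "\<dots> \<longleftrightarrow> (\<exists>k::int. z = 2 * of_real pi * \<i> * of_int k - Ln l)"
    unfolding exp_eq_1 by (auto simp: complex_eq_iff algebra_simps)
  finally show ?thesis
    by (auto simp: apostol_bernoulli_poles_def)
qed

lemma apostol_bernoulli_poles_eq:
  assumes "l \<noteq> 0"
  shows "apostol_bernoulli_poles l = {z. is_pole (apostol_bernoulli_gen x l) z}"
proof (intro set_eqI iffI; unfold mem_Collect_eq)
  fix z assume z: "z \<in> apostol_bernoulli_poles l"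
  then have e: "l * exp z = 1" and "l = 1 \<longrightarrow> z \<noteq> 0"
    using exp_eq_inverse_iff_poles[OF assms, of z] by auto
  then have z0: "z \<noteq> 0" by auto
  have "l * exp (z + of_real pi * \<i>) - 1 \<noteq> 0"
    using e by (simp add: exp_add)
  then have "\<forall>\<^sub>F w in at z. l * exp w - 1 \<noteq> 0 \<and> w \<in> UNIV"
    by (intro non_zero_neighbour_alt[where \<beta> = "z + of_real pi * \<i>"] holomorphic_intros) auto
  then have "\<forall>\<^sub>F w in at z. l * exp w - 1 \<noteq> 0" by simp
  moreover have "(\<lambda>w. l * exp w - 1) \<midarrow>z\<rightarrow> 0"
    using e by (auto intro!: tendsto_eq_intros)
  ultimately show "is_pole (apostol_bernoulli_gen x l) z"
    unfolding apostol_bernoulli_gen_def using z0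
    by (intro is_pole_divide) (auto simp: filterlim_at)
next
  fix z assume p: "is_pole (apostol_bernoulli_gen x l) z"
  have "l * exp z = 1"
  proof (rule ccontr)
    assume "l * exp z \<noteq> 1"
    then have "apostol_bernoulli_gen x l analytic_on {z}"
      unfolding apostol_bernoulli_gen_def by (auto intro!: analytic_intros)
    with p show False using analytic_at_imp_no_pole by blast
  qed
  moreover have "z \<noteq> 0" if "l = 1"
  proof
    assume "z = 0"
    with p have "is_pole (apostol_bernoulli_gen x l) 0" by simp
    then show False
      using not_tendsto_and_filterlim_at_infinity[OF at_neq_bot apostol_bernoulli_gen_tendsto[of x l]]
      by (simp add: is_pole_def)
  qed
  ultimately show "z \<in> apostol_bernoulli_poles l"
    using exp_eq_inverse_iff_poles[OF assms, of z] by auto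
qed

lemma apostol_bernoulli_poles_infinite: "infinite (apostol_bernoulli_poles l)"
proof -
  define w where "w = (if l = 1 then 0 else Ln l)"
  define f where "f k = 2 * of_real pi * \<i> * of_int k - w" for k :: int
  have "inj f" by (auto simp: inj_def f_def)
  moreover have "infinite (UNIV - {0} :: int set)" by (simp add: infinite_UNIV_int)
  ultimately have "infinite (f ` (UNIV - {0}))"
    by (meson finite_imageD inj_on_subset subset_UNIV)
  moreover have "f ` (UNIV - {0}) \<subseteq> apostol_bernoulli_poles l"
    by (auto simp: apostol_bernoulli_poles_def f_def w_def)
  ultimately show ?thesis using finite_subset by blast
qed

lemma apostol_bernoulli_poles_locally_finite:
  "finite {a \<in> apostol_bernoulli_poles l. norm a \<le> R}"
proof -
  define w where "w = (if l = 1 then 0 else Ln l)"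
  define f where "f k = 2 * of_real pi * \<i> * of_int k - w" for k :: int
  define N where "N = \<lceil>R + norm w\<rceil>"
  have "\<bar>k\<bar> \<le> N" if "norm (f k) \<le> R" for k
  proof -
    have "norm (2 * of_real pi * \<i> * of_int k) \<le> norm (f k) + norm w"
      unfolding f_def by (metis diff_add_cancel norm_triangle_ineq)
    then have "2 * pi * \<bar>of_int k\<bar> \<le> R + norm w"
      using that by (simp add: norm_mult)
    moreover have "1 * \<bar>of_int k\<bar> \<le> 2 * pi * \<bar>of_int k :: real\<bar>"
      using pi_gt3 by (intro mult_right_mono) auto
    ultimately have "of_int \<bar>k\<bar> \<le> R + norm w" by simp
    then show ?thesis unfolding N_def by linarith
  qed
  moreover have "\<exists>k. a = f k" if "a \<in> apostol_bernoulli_poles l" for a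
    using that by (auto simp: apostol_bernoulli_poles_def f_def w_def split: if_splits)
  ultimately have "{a \<in> apostol_bernoulli_poles l. norm a \<le> R} \<subseteq> f ` {k. \<bar>k\<bar> \<le> N}"
    by blast
  moreover have "{k. \<bar>k\<bar> \<le> N} = {-N..N}" by auto
  ultimately have "{a \<in> apostol_bernoulli_poles l. norm a \<le> R} \<subseteq> f ` {-N..N}" by simp
  then show ?thesis using finite_subset by blast
qed

lemma apostol_bernoulli_poles_Diff_has_least:
  assumes "finite F" and "\<mu> = (LEAST r. r \<in> norm ` (apostol_bernoulli_poles l - F))"
  shows "\<mu> \<in> norm ` (apostol_bernoulli_poles l - F)"
    and "\<forall>a \<in> apostol_bernoulli_poles l - F. \<mu> \<le> norm a"
proof -
  let ?P = "apostol_bernoulli_poles l - F"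
  have "infinite ?P"
    using apostol_bernoulli_poles_infinite assms(1) by (rule Diff_infinite_finite[rotated])
  then have "?P \<noteq> {}" by (metis finite.emptyI)
  then obtain b where b: "b \<in> ?P" by blast
  let ?T = "{a \<in> ?P. norm a \<le> norm b}"
  have fin: "finite ?T"
    by (rule finite_subset[OF _ apostol_bernoulli_poles_locally_finite[of l "norm b"]]) auto
  have "b \<in> ?T" using b by simp
  then obtain m where m: "m \<in> ?T" "\<forall>a\<in>?T. norm m \<le> norm a"
    using ex_min_if_finite[of "norm ` ?T"] fin by (auto simp: not_less)
  have le: "norm m \<le> norm a" if "a \<in> ?P" for a
    using m that by (cases "norm a \<le> norm b") auto
  have "\<mu> = norm m"
    unfolding assms(2) by (rule Least_equality) (use m le in auto)
  with m le show "\<mu> \<in> norm ` ?P" and "\<forall>a \<in> ?P. \<mu> \<le> norm a" by auto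
qed

end

theory Submission
  imports Defs
begin

text \<open>
  Write $b_n$ for the value of the $n$-th Apostol-Bernoulli polynomial at $0$ divided by $n!$, and
  $e_n = b_n + \sum_{a \in F} a^{-n}$ for the error at $0$. The generating function at $x = 0$ has
  only simple poles, with residue $a$ at the pole $a$. Hence $b_n + \sum_{a \in F'} a^{-n}$ are the
  Taylor coefficients of this function with the poles in $F'$ removed, and they are $O(r^{-n})$ for
  every $r$ below the modulus of the poles that remain
  (\<open>norm_apostol_bernoulli_plus_poles_le\<close>). Removing also the poles of modulus $\mu$ shows that
  $E_n = |e_n| \mu^n$ is bounded.

  The factor $e^{xz}$ turns the values at $0$ into values at $z$ by convolution with $z^k/k!$. The
  error at $z$, multiplied by $\mu^n$, is therefore at most
  \[ \sum_{k \le n} E_{n-k} \frac{X^k}{k!} + |F| \sum_{k > n} \frac{X^k}{k!}, \qquad X = \mu |z| \]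
  (\<open>norm_apostol_bernoulli_plus_poles_le_exp_sums\<close>); with $E$ bounded, this is at most a constant
  times $e^X$, which is the first claim.

  For the second claim, $E_m \le c$ is known for $m \ge 2$ only, so that the terms with
  $k = n - 1$, $k = n$ and $k > n$ may exceed their share $c X^k/k!$ of $c e^X$. All of them are
  $O(X^{n-1}/(n-1)!)$. If $E_p < c$ for just one $p \ge 2$, the term $k = n - p$ leaves a gap of
  $(c - E_p) X^{n-p}/(n-p)!$, which is larger by a factor of order $n$ at least when $X$ is bounded,
  and hence pays for the excess once $n$ is large (\<open>exp_convolution_le_eventually\<close>).

  Such a $p$ always exists, since $E$ is not constant from $2$ on
  (\<open>two_layer_power_sum_norm_not_constant\<close>). Up to sign, $e_n$ is the sum of $a^{-n}$ over the poles
  of modulus $\mu$, plus the sum over the poles of the next larger modulus, plus a smaller error.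
  Powers of finitely many unit complex numbers return simultaneously to any neighbourhood of $1$. By
  this recurrence, constant $E$ leaves room for only one pole of modulus $\mu$, and then the second
  layer makes $E$ exceed its limit infinitely often.
\<close>

section \<open>Recurrence and sums of powers with constant modulus\<close>

lemma finite_unit_powers_convergent_subseq:
  fixes U :: "complex set"
  assumes "finite U" and "\<And>u. u \<in> U \<Longrightarrow> norm u = 1"
  shows "\<exists>q :: nat \<Rightarrow> nat. strict_mono q \<and> (\<forall>u\<in>U. convergent (\<lambda>k. u ^ q k))"
  using assms
proof (induction U rule: finite_induct)
  case empty
  then show ?case by (auto intro: exI[of _ id] simp: strict_mono_id)
next
  case (insert v U)
  then obtain q :: "nat \<Rightarrow> nat" where q: "strict_mono q" "\<forall>u\<in>U. convergent (\<lambda>k. u ^ q k)"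
    by auto
  have "bounded (range (\<lambda>k. v ^ q k))"
    using insert.prems by (intro boundedI[of _ 1]) (auto simp: norm_power)
  then obtain L r where r: "strict_mono (r :: nat \<Rightarrow> nat)" "((\<lambda>k. v ^ q k) \<circ> r) \<longlonglongrightarrow> L"
    using bounded_imp_convergent_subsequence by blast
  have "convergent (\<lambda>k. u ^ (q \<circ> r) k)" if "u \<in> U" for u
  proof -
    have "convergent ((\<lambda>k. u ^ q k) \<circ> r)"
      by (intro convergent_subseq_convergent q(2)[rule_format] that r(1))
    then show ?thesis by (simp add: o_def)
  qed
  moreover have "convergent (\<lambda>k. v ^ (q \<circ> r) k)"
    using r(2) by (auto simp: o_def convergent_def)
  moreover have "strict_mono (q \<circ> r)"
    using q(1) r(1) by (rule strict_mono_o)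
  ultimately show ?case by (metis insertE)
qed

text \<open>
  If the powers with exponents $q_k$ converge to $L$, then so do those with exponents $q_{j_k}$, and
  the powers with exponents $q_{j_k} - q_k$ converge to $L / L = 1$.
\<close>

lemma finite_unit_powers_recurrent:
  fixes U :: "complex set"
  assumes "finite U" and "\<And>u. u \<in> U \<Longrightarrow> norm u = 1"
  shows "\<exists>m :: nat \<Rightarrow> nat. filterlim m at_top sequentially \<and> (\<forall>u\<in>U. (\<lambda>k. u ^ m k) \<longlonglongrightarrow> 1)"
proof -
  obtain q :: "nat \<Rightarrow> nat" where q: "strict_mono q" "\<forall>u\<in>U. convergent (\<lambda>k. u ^ q k)"
    using finite_unit_powers_convergent_subseq[OF assms] by blast
  \<comment> \<open>Advancing by \<open>q k + k\<close> steps makes the difference of exponents at least \<open>k\<close>.\<close>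
  define j where "j k = q k + k" for k
  define m where "m k = q (j k) - q k" for k
  have jq: "q (j k) \<ge> q k + k" for k
    using strict_mono_imp_increasing[OF q(1)] by (auto simp: j_def)
  have "m k \<ge> k" for k using jq[of k] by (simp add: m_def)
  then have "filterlim m at_top sequentially"
    by (intro filterlim_at_top_mono[OF filterlim_ident]) auto
  moreover have "(\<lambda>k. u ^ m k) \<longlonglongrightarrow> 1" if u: "u \<in> U" for u
  proof -
    obtain L where L: "(\<lambda>k. u ^ q k) \<longlonglongrightarrow> L" using q(2) u by (auto simp: convergent_def)
    have "(\<lambda>k. norm (u ^ q k)) \<longlonglongrightarrow> norm L" by (intro tendsto_intros L)
    then have "norm L = 1"
      using assms(2)[OF u] by (simp add: norm_power LIMSEQ_const_iff)
    moreover have "filterlim j at_top sequentially"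
      by (intro filterlim_at_top_mono[OF filterlim_ident]) (auto simp: j_def)
    then have "(\<lambda>k. u ^ q (j k)) \<longlonglongrightarrow> L" by (rule filterlim_compose[OF L])
    ultimately have "(\<lambda>k. u ^ q (j k) / u ^ q k) \<longlonglongrightarrow> L / L"
      by (intro tendsto_divide L) auto
    moreover have "u ^ q (j k) / u ^ q k = u ^ m k" for k
      using jq[of k] assms(2)[OF u] unfolding m_def by (subst power_diff) auto
    moreover have "L \<noteq> 0" using \<open>norm L = 1\<close> by auto
    ultimately show ?thesis by simp
  qed
  ultimately show ?thesis by blast
qed

lemma norm_sum_eq_card_imp_eq:
  fixes f :: "'a \<Rightarrow> complex"
  assumes "finite A" and "\<And>a. a \<in> A \<Longrightarrow> norm (f a) = 1"
    and "norm (\<Sum>a\<in>A. f a) = card A" and "a \<in> A" "b \<in> A"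
  shows "f a = f b"
proof (cases "a = b")
  case False
  have eq: "(\<Sum>x\<in>A. f x) = (f a + f b) + (\<Sum>x\<in>A - {a, b}. f x)"
    using assms False by (subst sum.subset_diff[of "{a,b}"]) auto
  have "norm (\<Sum>x\<in>A - {a, b}. f x) \<le> (\<Sum>x\<in>A - {a, b}. 1)"
    using assms(2) by (intro order_trans[OF norm_sum] sum_mono) auto
  also have "\<dots> = real (card A) - 2"
  proof -
    have "card {a, b} \<le> card A" using assms by (intro card_mono) auto
    then show ?thesis using assms False by (simp add: card_Diff_subset of_nat_diff)
  qed
  finally have "norm (f a + f b) \<ge> 2"
    using assms(3) norm_triangle_ineq[of "f a + f b" "\<Sum>x\<in>A - {a, b}. f x"] unfolding eq by linarith
  then have "norm (f a + f b) = norm (f a) + norm (f b)"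
    using norm_triangle_ineq[of "f a" "f b"] assms by auto
  then show ?thesis
    unfolding norm_triangle_eq using assms by simp
qed simp

text \<open>
  Suppose that $|e_n| \mu^n = c$ for $n \ge 2$. To leading order $-e_n \mu^n$ is the sum $S_n$ of the
  $n$-th powers of the unit numbers $\mu/a$, so $|S_n| \to c$. Along recurrence times
  $S_{m_k}$ tends to the number of summands and $S_{m_k+1}$ tends to $S_1$. Hence $|S_1|$ equals the
  number of summands, which forces all summands to be equal: there is only one $a$, and $c = 1$.

  Then $-e_n a^n = 1 + V_n$ where $V_n = O((\mu/\rho)^n)$, and $|1 + V_n| = 1$ means
  $2 \,\mathrm{Re}\, V_n = -|V_n|^2$, a quantity of smaller order. But along recurrence times for the
  ratios $(\rho/b) / (\mu/a)$, the number $(\rho/\mu)^n V_n$ tends to the number of elements of $B$,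
  which is not $0$.
\<close>

lemma two_layer_power_sum_norm_not_constant:
  fixes e :: "nat \<Rightarrow> complex" and A B :: "complex set" and \<mu> \<rho> r c D :: real
  assumes "finite A" "A \<noteq> {}" "\<And>a. a \<in> A \<Longrightarrow> norm a = \<mu>"
    and "finite B" "B \<noteq> {}" "\<And>b. b \<in> B \<Longrightarrow> norm b = \<rho>"
    and "0 < \<mu>" "\<mu> < \<rho>" "\<rho> < r"
    and bound: "\<And>n. norm (e n + (\<Sum>a\<in>A. 1 / a ^ n) + (\<Sum>b\<in>B. 1 / b ^ n)) \<le> D / r ^ n"
  shows "\<exists>n\<ge>2. norm (e n) * \<mu> ^ n \<noteq> c"
proof (rule ccontr)
  assume "\<not> ?thesis"
  then have const: "norm (e n) * \<mu> ^ n = c" if "n \<ge> 2" for n using that by auto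
  define w where "w n = e n + (\<Sum>a\<in>A. 1 / a ^ n) + (\<Sum>b\<in>B. 1 / b ^ n)" for n
  have w: "(\<lambda>n. w n * t ^ n) \<longlonglongrightarrow> 0" if "norm t < r" for t
  proof (rule Lim_null_comparison)
    show "\<forall>\<^sub>F n in sequentially. norm (w n * t ^ n) \<le> D * (norm t / r) ^ n"
    proof (intro always_eventually allI)
      fix n
      have "norm (w n * t ^ n) \<le> (D / r ^ n) * norm t ^ n"
        unfolding norm_mult norm_power w_def by (intro mult_right_mono bound) auto
      then show "norm (w n * t ^ n) \<le> D * (norm t / r) ^ n" by (simp add: power_divide)
    qed
    show "(\<lambda>n. D * (norm t / r) ^ n) \<longlonglongrightarrow> 0"
      using that assms by (intro tendsto_mult_right_zero LIMSEQ_power_zero) auto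
  qed
  have nz: "a \<noteq> 0" if "a \<in> A" for a using assms(3)[OF that] assms(7) by auto
  define S where "S n = (\<Sum>a\<in>A. (of_real \<mu> / a) ^ n)" for n
  define U where "U = (\<lambda>a. of_real \<mu> / a) ` A \<union> (\<lambda>b. of_real \<rho> / b) ` B"
  have "finite U" using assms(1,4) by (simp add: U_def)
  moreover have "norm u = 1" if "u \<in> U" for u
    using that assms(3,6-8) by (auto simp: U_def norm_divide)
  ultimately have "\<exists>m :: nat \<Rightarrow> nat. filterlim m at_top sequentially \<and> (\<forall>u\<in>U. (\<lambda>k. u ^ m k) \<longlonglongrightarrow> 1)"
    by (rule finite_unit_powers_recurrent)
  then obtain m :: "nat \<Rightarrow> nat" where m: "filterlim m at_top sequentially"
    "\<And>u. u \<in> U \<Longrightarrow> (\<lambda>k. u ^ m k) \<longlonglongrightarrow> 1"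
    by auto
  have ES: "(\<lambda>n. e n * of_real \<mu> ^ n + S n) \<longlonglongrightarrow> 0"
  proof -
    have "(\<lambda>n. w n * of_real \<mu> ^ n - (\<Sum>b\<in>B. (of_real \<mu> / b) ^ n)) \<longlonglongrightarrow> 0 - (\<Sum>b\<in>B. 0)"
      using assms by (intro tendsto_diff tendsto_sum w LIMSEQ_power_zero) (auto simp: norm_divide)
    moreover have "w n * of_real \<mu> ^ n - (\<Sum>b\<in>B. (of_real \<mu> / b) ^ n) = e n * of_real \<mu> ^ n + S n" for n
      by (simp add: w_def S_def algebra_simps sum_distrib_left power_divide)
    ultimately show ?thesis by simp
  qed
  have Sc: "(\<lambda>n. norm (S n)) \<longlonglongrightarrow> c"
  proof -
    have "(\<lambda>n. norm (S n) - norm (e n) * \<mu> ^ n) \<longlonglongrightarrow> 0"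
    proof (rule Lim_null_comparison[OF always_eventually])
      show "(\<lambda>n. norm (e n * of_real \<mu> ^ n + S n)) \<longlonglongrightarrow> 0" using ES by (rule tendsto_norm_zero)
      have "\<bar>norm (S n) - norm (- (e n * of_real \<mu> ^ n))\<bar> \<le> norm (S n - - (e n * of_real \<mu> ^ n))" for n
        by (rule norm_triangle_ineq3)
      then show "\<forall>n. norm (norm (S n) - norm (e n) * \<mu> ^ n) \<le> norm (e n * of_real \<mu> ^ n + S n)"
        using assms(7) by (simp add: norm_mult norm_power add.commute)
    qed
    moreover have "(\<lambda>n. norm (e n) * \<mu> ^ n) \<longlonglongrightarrow> c"
      by (intro tendsto_eventually eventually_sequentiallyI[of 2] const)
    ultimately have "(\<lambda>n. (norm (S n) - norm (e n) * \<mu> ^ n) + norm (e n) * \<mu> ^ n) \<longlonglongrightarrow> 0 + c"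
      by (rule tendsto_add)
    then show ?thesis by simp
  qed
  have "(\<lambda>k. S (m k)) \<longlonglongrightarrow> (\<Sum>a\<in>A. 1)"
    unfolding S_def by (intro tendsto_sum m) (auto simp: U_def)
  then have "(\<lambda>k. norm (S (m k))) \<longlonglongrightarrow> norm (\<Sum>a\<in>A. 1 :: complex)" by (rule tendsto_norm)
  with filterlim_compose[OF Sc m(1)] have c: "c = card A"
    using LIMSEQ_unique by fastforce
  have "(\<lambda>k. S (m k + 1)) \<longlonglongrightarrow> (\<Sum>a\<in>A. 1 * (of_real \<mu> / a) ^ 1)"
    unfolding S_def power_add by (intro tendsto_sum tendsto_mult tendsto_const m) (auto simp: U_def)
  then have "(\<lambda>k. norm (S (m k + 1))) \<longlonglongrightarrow> norm (\<Sum>a\<in>A. of_real \<mu> / a)"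
    by (auto dest: tendsto_norm)
  moreover have "filterlim (\<lambda>k. m k + 1) at_top sequentially"
    by (rule filterlim_at_top_mono[OF m(1)]) auto
  then have "(\<lambda>k. norm (S (m k + 1))) \<longlonglongrightarrow> c" by (rule filterlim_compose[OF Sc])
  ultimately have "norm (\<Sum>a\<in>A. of_real \<mu> / a) = card A"
    using LIMSEQ_unique c by blast
  then have inj: "of_real \<mu> / a = of_real \<mu> / b" if "a \<in> A" "b \<in> A" for a b
    using assms(1,3,7) that by (intro norm_sum_eq_card_imp_eq[of A]) (auto simp: norm_divide)
  obtain a where a: "a \<in> A" using assms(2) by blast
  have A: "A = {a}"
  proof -
    have "b = a" if "b \<in> A" for b
      using inj[OF that a] nz[OF a] nz[OF that] assms(7) by (simp add: divide_eq_eq eq_divide_eq)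
    then show ?thesis using a by blast
  qed
  have na: "norm a = \<mu>" using a assms(3) by blast
  \<comment> \<open>The contribution of the second layer, relative to the single dominant term:\<close>
  define V where "V n = (\<Sum>b\<in>B. (a / b) ^ n) - w n * a ^ n" for n
  have eV: "e n * a ^ n = - (1 + V n)" for n
    using nz[OF a] by (simp add: V_def w_def A algebra_simps sum_distrib_left power_divide)
  have one: "norm (1 + V n) = 1" if "n \<ge> 2" for n
  proof -
    have "norm (1 + V n) = norm (e n * a ^ n)" unfolding eV by (rule norm_minus_cancel[symmetric])
    then show ?thesis using const[OF that] c A na by (simp add: norm_mult norm_power)
  qed
  define t where "t = \<rho> / \<mu>"
  have t: "t > 1" using assms(7,8) by (simp add: t_def)
  \<comment> \<open>Rescaled so that, up to a vanishing error, the second layer becomes a sum of powers of unit numbers:\<close>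
  define T where "T n = of_real t ^ n * V n" for n
  have "T n = (\<Sum>b\<in>B. (of_real \<rho> / b) ^ n / (of_real \<mu> / a) ^ n) - w n * (of_real t * a) ^ n" for n
    using assms(7) nz[OF a]
    by (simp add: T_def V_def t_def sum_distrib_left power_divide power_mult_distrib algebra_simps)
  moreover have "(\<lambda>k. (\<Sum>b\<in>B. (of_real \<rho> / b) ^ m k / (of_real \<mu> / a) ^ m k) 
      - w (m k) * (of_real t * a) ^ m k) \<longlonglongrightarrow> (\<Sum>b\<in>B. 1 / 1) - 0"
  proof (intro tendsto_diff tendsto_sum tendsto_divide m filterlim_compose[OF w m(1)])
    show "norm (of_real t * a) < r"
      using na assms(7-9) by (simp add: norm_mult norm_divide t_def)
  qed (use a in \<open>auto simp: U_def\<close>)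
  ultimately have T: "(\<lambda>k. T (m k)) \<longlonglongrightarrow> card B" by simp
  have "(\<lambda>k. (1 / of_real t) ^ m k) \<longlonglongrightarrow> (0 :: complex)"
    using t by (intro filterlim_compose[OF LIMSEQ_power_zero m(1)]) (auto simp: norm_divide)
  then have "(\<lambda>k. T (m k) * (1 / of_real t) ^ m k) \<longlonglongrightarrow> of_nat (card B) * 0" by (intro tendsto_mult T)
  moreover have "T n * (1 / of_real t) ^ n = V n" for n
    using t by (simp add: T_def field_simps)
  ultimately have V: "(\<lambda>k. V (m k)) \<longlonglongrightarrow> 0" by simp
  have lim: "(\<lambda>k. 2 * Re (T (m k)) + Re (T (m k) * cnj (V (m k)))) \<longlonglongrightarrow>
      2 * Re (of_nat (card B)) + Re (of_nat (card B) * cnj 0)"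
    by (intro tendsto_intros T V)
  have "2 * Re (T n) + Re (T n * cnj (V n)) = 0" if "n \<ge> 2" for n
  proof -
    have "(norm (1 + V n))\<^sup>2 = 1" using one[OF that] by simp
    then have "2 * Re (V n) + (Re (V n))\<^sup>2 + (Im (V n))\<^sup>2 = 0"
      unfolding cmod_power2 by (simp add: power2_eq_square algebra_simps)
    then have "t ^ n * (2 * Re (V n) + (Re (V n))\<^sup>2 + (Im (V n))\<^sup>2) = 0" by simp
    moreover have "T n = of_real (t ^ n) * V n" by (simp add: T_def)
    ultimately show ?thesis by (simp add: power2_eq_square algebra_simps)
  qed
  moreover have "\<forall>\<^sub>F k in sequentially. m k \<ge> 2"
    using m(1) unfolding filterlim_at_top by blast
  ultimately have "\<forall>\<^sub>F k in sequentially. 2 * Re (T (m k)) + Re (T (m k) * cnj (V (m k))) = 0"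
    by (auto elim: eventually_mono)
  then have "(\<lambda>k. 2 * Re (T (m k)) + Re (T (m k) * cnj (V (m k)))) \<longlonglongrightarrow> 0"
    by (rule tendsto_eventually)
  with lim have "2 * Re (of_nat (card B)) + Re (of_nat (card B) * cnj 0) = 0"
    by (rule LIMSEQ_unique)
  then show False using assms(4,5) by simp
qed

section \<open>Partial sums of the exponential series\<close>

text \<open>
  The index \<open>n\<close> is included in the partial sum although the bound is the Lagrange remainder of order
  \<open>n\<close>. The cruder bound matches the powers that occur in \<open>exp_convolution_le_eventually\<close>.
\<close>

lemma exp_minus_partial_sum_le:
  fixes x :: real
  assumes "0 \<le> x"
  shows "exp x - (\<Sum>k\<le>n. x ^ k / fact k) \<le> x ^ n / fact n * exp x"
proof -
  obtain t where t: "\<bar>t\<bar> \<le> \<bar>x\<bar>" "exp x = (\<Sum>m<n. x ^ m / fact m) + exp t / fact n * x ^ n"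
    using Maclaurin_exp_le by blast
  have "exp t * (x ^ n / fact n) \<le> exp x * (x ^ n / fact n)"
    using t(1) assms by (intro mult_right_mono) auto
  then have "exp t / fact n * x ^ n \<le> x ^ n / fact n * exp x" by (simp add: mult.commute)
  moreover have "(\<Sum>k\<le>n. x ^ k / fact k) = (\<Sum>k<n. x ^ k / fact k) + x ^ n / fact n"
    by (simp add: lessThan_Suc_atMost[symmetric])
  moreover have "0 \<le> x ^ n / fact n" using assms by simp
  ultimately show ?thesis using t(2) by linarith
qed

lemma exp_minus_partial_sum_sums:
  fixes x :: "'a :: {real_normed_field, banach}"
  shows "(\<lambda>k. x ^ (k + Suc n) / fact (k + Suc n)) sums (exp x - (\<Sum>k\<le>n. x ^ k / fact k))"
proof -
  have "(\<lambda>k. x ^ k / fact k) sums exp x"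
    using exp_converges[of x] by (simp add: scaleR_conv_of_real field_simps)
  from sums_split_initial_segment[OF this, of "Suc n"] show ?thesis
    by (simp add: lessThan_Suc_atMost)
qed

lemma partial_sum_le_exp:
  fixes x :: real
  assumes "0 \<le> x"
  shows "(\<Sum>k\<le>n. x ^ k / fact k) \<le> exp x"
proof -
  have "0 \<le> (\<Sum>k. x ^ (k + Suc n) / fact (k + Suc n))"
    using assms by (intro suminf_nonneg sums_summable[OF exp_minus_partial_sum_sums]) auto
  also have "\<dots> = exp x - (\<Sum>k\<le>n. x ^ k / fact k)"
    by (rule sums_unique[OF exp_minus_partial_sum_sums, symmetric])
  finally show ?thesis by simp
qed

text \<open>
  The remainder contains only powers $a^k$ with $k > n$. After division by $a^n$ all exponents of $a$
  are positive, so that $|a|$ may be replaced by the larger $\mu$.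
\<close>

lemma norm_exp_remainder_div_power_le:
  fixes a x :: complex
  assumes "a \<noteq> 0" "norm a \<le> \<mu>"
  shows "norm ((exp (a * x) - (\<Sum>k\<le>n. (a * x) ^ k / fact k)) / a ^ n)
    \<le> (exp (\<mu> * norm x) - (\<Sum>k\<le>n. (\<mu> * norm x) ^ k / fact k)) / \<mu> ^ n"
proof -
  have \<mu>: "\<mu> > 0" using assms by (meson less_le_trans zero_less_norm_iff)
  define f where "f k = (a * x) ^ (k + Suc n) / fact (k + Suc n) / a ^ n" for k
  define g where "g k = (\<mu> * norm x) ^ (k + Suc n) / fact (k + Suc n) / \<mu> ^ n" for k
  have f: "f sums ((exp (a * x) - (\<Sum>k\<le>n. (a * x) ^ k / fact k)) / a ^ n)"
    unfolding f_def by (intro sums_divide exp_minus_partial_sum_sums)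
  have g: "g sums ((exp (\<mu> * norm x) - (\<Sum>k\<le>n. (\<mu> * norm x) ^ k / fact k)) / \<mu> ^ n)"
    unfolding g_def by (intro sums_divide exp_minus_partial_sum_sums)
  have cancel: "(p * u) / v / p = u / v" if "p \<noteq> 0" for p u v :: "complex"
    using that by simp
  have cancel': "(p * u) / v / p = u / v" if "p \<noteq> 0" for p u v :: real
    using that by simp
  have "norm (f k) \<le> g k" for k
  proof -
    have "(a * x) ^ (k + Suc n) = a ^ n * (a ^ Suc k * x ^ (k + Suc n))"
      by (simp add: power_mult_distrib power_add)
    then have "f k = a ^ Suc k * x ^ (k + Suc n) / fact (k + Suc n)"
      unfolding f_def using cancel[OF power_not_zero[OF assms(1)]] by (simp only:)
    then have "norm (f k) = norm a ^ Suc k * norm x ^ (k + Suc n) / fact (k + Suc n)"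
      by (simp only: norm_mult norm_divide norm_power norm_fact)
    also have "\<dots> \<le> \<mu> ^ Suc k * norm x ^ (k + Suc n) / fact (k + Suc n)"
      using assms(2) by (intro divide_right_mono mult_right_mono power_mono) auto
    also have "\<dots> = g k"
    proof -
      have eq: "(\<mu> * norm x) ^ (k + Suc n) = \<mu> ^ n * (\<mu> ^ Suc k * norm x ^ (k + Suc n))"
        by (simp add: power_mult_distrib power_add)
      have "\<mu> ^ n \<noteq> 0" using \<mu> by simp
      then show ?thesis unfolding g_def eq by (rule cancel'[symmetric])
    qed
    finally show ?thesis .
  qed
  then have "norm (suminf f) \<le> suminf g"
    by (intro norm_suminf_le sums_summable[OF g])
  then show ?thesis using f g by (simp add: sums_unique[symmetric])
qed

text \<open>
  The difference of the two sides is the sum over $k \le n$ of $(c - E_{n-k}) x^k/k!$ plus $c - d$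
  times the remainder of the exponential series. Its only terms of unknown sign are those with
  $k = n - 1$ and $k = n$ and the remainder, which together are at most a constant $D$ times
  $y = x^{n-1}/(n-1)!$. The term with $k = n - p$ equals $c - E_p > 0$ times $z = x^{n-p}/(n-p)!$, and
  $y \le z \, R^{p-1}/(n-1)$ because $(n-1)! \ge (n-1) \, (n-p)!$ for $p \ge 2$.
\<close>

lemma exp_convolution_le_eventually:
  fixes E :: "nat \<Rightarrow> real" and c d R :: real
  assumes "R \<ge> 0" and le: "\<And>m. m \<ge> 2 \<Longrightarrow> E m \<le> c" and "p \<ge> 2" and "E p < c"
  shows "\<exists>N. \<forall>n\<ge>N. \<forall>x. 0 \<le> x \<and> x \<le> R \<longrightarrow>
    (\<Sum>k\<le>n. E (n - k) * x ^ k / fact k) + d * (exp x - (\<Sum>k\<le>n. x ^ k / fact k)) \<le> c * exp x"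
proof -
  define D where "D = \<bar>c - E 1\<bar> + \<bar>c - E 0\<bar> * R + \<bar>c - d\<bar> * (R * exp R)"
  obtain N where N: "real N \<ge> D * R ^ (p - 1) / (c - E p)" using real_arch_simple by blast
  have "(\<Sum>k\<le>n. E (n - k) * x ^ k / fact k) + d * (exp x - (\<Sum>k\<le>n. x ^ k / fact k)) \<le> c * exp x"
    if n: "n \<ge> N + p + 1" and x: "0 \<le> x" "x \<le> R" for n x
  proof -
    define y where "y = x ^ (n - 1) / fact (n - 1)"
    define z where "z = x ^ (n - p) / fact (n - p)"
    define q where "q = exp x - (\<Sum>k\<le>n. x ^ k / fact k)"
    have y0: "y \<ge> 0" and z0: "z \<ge> 0" using x by (auto simp: y_def z_def)
    have xn: "x ^ n / fact n \<le> R * y"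
    proof -
      obtain k where k: "n = Suc k" using n by (cases n) auto
      have "x ^ n / fact n = x / n * y" by (simp add: k y_def)
      also have "\<dots> \<le> R * y"
      proof (intro mult_right_mono y0)
        have "x / n \<le> x / 1" using x n by (intro divide_left_mono) auto
        then show "x / n \<le> R" using x by simp
      qed
      finally show ?thesis .
    qed
    have q: "q \<le> R * exp R * y"
    proof -
      have "q \<le> x ^ n / fact n * exp x" unfolding q_def by (rule exp_minus_partial_sum_le[OF x(1)])
      also have "\<dots> \<le> (R * y) * exp R"
        using x xn assms(1) y0 by (intro mult_mono) auto
      finally show ?thesis by (simp add: mult_ac)
    qed
    have q0: "q \<ge> 0" unfolding q_def using partial_sum_le_exp[OF x(1)] by simp
    have dom: "D * y \<le> (c - E p) * z"
    proof -
      have "fact (n - p) * real (n - 1) \<le> fact (n - 1)"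
      proof -
        have "fact (n - p) * (n - 1) \<le> fact (n - 2) * (n - 1)"
          using assms(3) by (intro mult_right_mono fact_mono_nat) auto
        also have "\<dots> = fact (n - 1)"
          using n assms(3) by (subst (2) fact_reduce) (auto simp: mult.commute numeral_2_eq_2)
        finally have "real (fact (n - p) * (n - 1)) \<le> real (fact (n - 1))" by (rule of_nat_mono)
        then show ?thesis by simp
      qed
      then have "y \<le> x ^ (n - 1) / (fact (n - p) * real (n - 1))"
        unfolding y_def using x n assms(3) by (intro divide_left_mono) auto
      also have "x ^ (n - 1) = x ^ (n - p) * x ^ (p - 1)"
        using n assms(3) by (simp flip: power_add)
      also have "\<dots> / (fact (n - p) * real (n - 1)) = z * (x ^ (p - 1) / real (n - 1))"
        by (simp add: z_def)
      also have "\<dots> \<le> z * (R ^ (p - 1) / real (n - 1))"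
        using x z0 by (intro mult_left_mono divide_right_mono power_mono) auto
      finally have "D * y \<le> D * (z * (R ^ (p - 1) / real (n - 1)))"
        using assms(1) by (intro mult_left_mono) (auto simp: D_def)
      also have "\<dots> = z * (D * R ^ (p - 1) / real (n - 1))" by simp
      also have "\<dots> \<le> z * (c - E p)"
      proof (intro mult_left_mono z0)
        have "D * R ^ (p - 1) \<le> real N * (c - E p)"
          using N assms(4) by (simp add: field_simps)
        also have "\<dots> \<le> real (n - 1) * (c - E p)"
          using n assms(4) by (intro mult_right_mono) auto
        finally show "D * R ^ (p - 1) / real (n - 1) \<le> c - E p"
          using n assms(3) by (simp add: field_simps)
      qed
      finally show ?thesis by (simp add: mult_ac)
    qed
    have lower: "u * v \<ge> - (\<bar>u\<bar> * v)" if "v \<ge> 0" for u v :: real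
      using mult_right_mono[of "- \<bar>u\<bar>" u v] that by simp
    \<comment> \<open>\<open>s k\<close> is the amount by which the term of index \<open>k\<close> stays below its share of \<open>c * exp x\<close>.\<close>
    define s where "s k = (c - E (n - k)) * (x ^ k / fact k)" for k
    have "(\<Sum>k\<le>n. s k) = (\<Sum>k\<in>{..n} - {n - p, n - 1, n}. s k) + (\<Sum>k\<in>{n - p, n - 1, n}. s k)"
      by (intro sum.subset_diff) auto
    moreover have "(\<Sum>k\<in>{..n} - {n - p, n - 1, n}. s k) \<ge> 0"
    proof (intro sum_nonneg)
      fix k assume "k \<in> {..n} - {n - p, n - 1, n}"
      then have "n - k \<ge> 2" by auto
      then show "s k \<ge> 0" using le x by (auto simp: s_def)
    qed
    moreover have "(\<Sum>k\<in>{n - p, n - 1, n}. s k) = (c - E p) * z + (c - E 1) * y + (c - E 0) * (x ^ n / fact n)"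
    proof -
      have "n - p \<noteq> n - 1" "n - p \<noteq> n" "n - 1 \<noteq> n" "n - (n - p) = p" "n - (n - 1) = 1"
        using n assms(3) by auto
      then show ?thesis by (simp add: s_def y_def z_def)
    qed
    moreover have "(c - E 1) * y \<ge> - (\<bar>c - E 1\<bar> * y)"
      by (rule lower[OF y0])
    moreover have "(c - E 0) * (x ^ n / fact n) \<ge> - (\<bar>c - E 0\<bar> * (R * y))"
    proof -
      have "- ((c - E 0) * (x ^ n / fact n)) \<le> \<bar>c - E 0\<bar> * (x ^ n / fact n)"
        using lower[of "x ^ n / fact n" "c - E 0"] x by simp
      also have "\<dots> \<le> \<bar>c - E 0\<bar> * (R * y)" using xn by (intro mult_left_mono) auto
      finally show ?thesis by linarith
    qed
    moreover have "(c - d) * q \<ge> - (\<bar>c - d\<bar> * (R * exp R * y))"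
    proof -
      have "- ((c - d) * q) \<le> \<bar>c - d\<bar> * q"
        using lower[OF q0, of "c - d"] by simp
      also have "\<dots> \<le> \<bar>c - d\<bar> * (R * exp R * y)" using q by (intro mult_left_mono) auto
      finally show ?thesis by linarith
    qed
    moreover have "D * y = \<bar>c - E 1\<bar> * y + \<bar>c - E 0\<bar> * (R * y) + \<bar>c - d\<bar> * (R * exp R * y)"
      by (simp add: D_def algebra_simps)
    ultimately have "0 \<le> (\<Sum>k\<le>n. s k) + (c - d) * q" using dom by linarith
    also have "(\<Sum>k\<le>n. s k) = c * (\<Sum>k\<le>n. x ^ k / fact k) - (\<Sum>k\<le>n. E (n - k) * x ^ k / fact k)"
      by (simp add: s_def left_diff_distrib sum_subtractf sum_distrib_left diff_divide_distrib)
    finally show ?thesis by (simp add: q_def algebra_simps)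
  qed
  then show ?thesis by blast
qed

section \<open>The generating function and its poles\<close>

text \<open>
  The generating functions at $x$ and at $0$ differ by the factor $e^{xz}$, whose Taylor
  coefficients are $x^k/k!$.
\<close>

lemma apostol_bernoulli_Appell:
  "apostol_bernoulli n x l / fact n
    = (\<Sum>k\<le>n. x ^ k / fact k * (apostol_bernoulli (n - k) 0 l / fact (n - k)))"
proof -
  let ?g = "\<lambda>x. remove_sings (apostol_bernoulli_gen x l)"
  define B where "B x = Abs_fps (\<lambda>n. apostol_bernoulli n x l / fact n)" for x
  have B: "?g x has_fps_expansion B x" for x
    unfolding B_def by (rule apostol_bernoulli_gen_has_fps_expansion)
  have rs: "\<forall>\<^sub>F z in at 0. ?g x z = apostol_bernoulli_gen x l z" for x
    by (intro eventually_remove_sings_eq_at apostol_bernoulli_gen_isolated)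
  have "\<forall>\<^sub>F z in at 0. ?g x z = exp (x * z) * ?g 0 z"
    using rs[of x] rs[of 0] by eventually_elim (auto simp: apostol_bernoulli_gen_def)
  moreover have "?g x 0 = exp (x * 0) * ?g 0 0"
    using remove_sings_eqI[OF apostol_bernoulli_gen_tendsto] by simp
  ultimately have "\<forall>\<^sub>F z in nhds 0. ?g x z = exp (x * z) * ?g 0 z"
    by (simp add: eventually_nhds_conv_at)
  moreover have "(\<lambda>z. exp (x * z) * ?g 0 z) has_fps_expansion (fps_exp x * B 0)"
    by (intro fps_expansion_intros B)
  ultimately have "?g x has_fps_expansion (fps_exp x * B 0)"
    by (subst has_fps_expansion_cong[OF _ refl]) auto
  then have "B x = fps_exp x * B 0" using B fps_expansion_unique_complex by blast
  then have "fps_nth (B x) n = fps_nth (fps_exp x * B 0) n" by simp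
  then show ?thesis by (simp add: B_def fps_mult_nth atLeast0AtMost)
qed

text \<open>
  Every pole $a$ is simple with residue $a$. As $\lambda e^z = e^{z-a}$, the generating function is
  $z H(z-a)/(z-a)$, where $H(w) = w/(e^w-1)$ is analytic at $0$ with $H(0) = 1$. Subtracting
  $a/(z-a)$ leaves a difference quotient of $z H(z-a)$ at $a$.
\<close>

lemma apostol_bernoulli_gen_minus_principal_part_tendsto:
  assumes "l * exp a = 1"
  shows "\<exists>L. (\<lambda>z. apostol_bernoulli_gen 0 l z - a / (z - a)) \<midarrow>a\<rightarrow> L"
proof -
  define H where "H = remove_sings (apostol_bernoulli_gen 0 1)"
  have H0: "H 0 = 1"
    unfolding H_def using remove_sings_eqI[OF apostol_bernoulli_gen_tendsto[of 0 1]] by simp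
  have "H analytic_on {0}"
    unfolding H_def
    by (intro remove_sings_analytic_at[OF apostol_bernoulli_gen_isolated apostol_bernoulli_gen_tendsto])
  then obtain H' where H': "(H has_field_derivative H') (at 0)"
    using analytic_on_imp_differentiable_at field_differentiable_def by blast
  have "((\<lambda>z. z - a) has_field_derivative 1) (at a)"
    by (auto intro!: derivative_eq_intros)
  with H' have "((\<lambda>z. H (z - a)) has_field_derivative H' * 1) (at a)"
    by (intro DERIV_chain2[of H]) auto
  from DERIV_mult'[OF DERIV_ident this]
  have "((\<lambda>z. z * H (z - a)) has_field_derivative (a * H' + H 0)) (at a)" by simp
  then have "(\<lambda>z. (z * H (z - a) - a * H (a - a)) / (z - a)) \<midarrow>a\<rightarrow> (a * H' + H 0)"
    by (simp add: has_field_derivative_iff)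
  moreover have "\<forall>\<^sub>F z in at a. (z * H (z - a) - a * H (a - a)) / (z - a) = apostol_bernoulli_gen 0 l z - a / (z - a)"
  proof -
    have "\<forall>\<^sub>F w in at 0. H w = apostol_bernoulli_gen 0 1 w"
      unfolding H_def by (intro eventually_remove_sings_eq_at apostol_bernoulli_gen_isolated)
    then have "\<forall>\<^sub>F z in at a. H (z - a) = apostol_bernoulli_gen 0 1 (z - a)"
      by (simp add: at_to_0[of a] eventually_filtermap)
    moreover have "\<forall>\<^sub>F z in at a. z \<noteq> a" by (simp add: eventually_at_filter)
    ultimately show ?thesis
    proof eventually_elim
      case (elim z)
      have "l * exp z = exp (z - a)"
        using assms by (simp add: exp_diff field_simps)
      then have "apostol_bernoulli_gen 0 l z = z * H (z - a) / (z - a)"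
        using elim by (simp add: apostol_bernoulli_gen_def)
      then show ?case by (simp add: H0 diff_divide_distrib)
    qed
  qed
  ultimately have "(\<lambda>z. apostol_bernoulli_gen 0 l z - a / (z - a)) \<midarrow>a\<rightarrow> a * H' + H 0"
    by (rule Lim_transform_eventually)
  then show ?thesis by blast
qed

lemma has_fps_expansion_divide_diff:
  fixes a :: complex
  assumes "a \<noteq> 0"
  shows "(\<lambda>z. a / (z - a)) has_fps_expansion Abs_fps (\<lambda>n. - (1 / a ^ n))"
proof -
  define G where "G = fps_X - fps_const a"
  have exp: "(\<lambda>z. a / (z - a)) has_fps_expansion fps_const a / G"
    unfolding G_def using assms by (intro has_fps_expansion_divide' fps_expansion_intros) auto
  have G: "Abs_fps (\<lambda>n. - (1 / a ^ n)) * G = fps_const a"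
  proof (rule fps_ext)
    fix n show "fps_nth (Abs_fps (\<lambda>n. - (1 / a ^ n)) * G) n = fps_nth (fps_const a) n"
      using assms by (cases n) (auto simp: G_def right_diff_distrib)
  qed
  have "G \<noteq> 0"
  proof -
    have "fps_nth G 0 \<noteq> 0" using assms by (simp add: G_def)
    then show ?thesis by auto
  qed
  from nonzero_mult_div_cancel_right[OF this]
  have "Abs_fps (\<lambda>n. - (1 / a ^ n)) * G / G = Abs_fps (\<lambda>n. - (1 / a ^ n))" .
  then show ?thesis using exp unfolding G by simp
qed

text \<open>
  By the geometric series, $-a/(z-a)$ has the Taylor coefficients $a^{-n}$. The numbers to be bounded
  are thus the Taylor coefficients of the generating function minus the principal parts at the poles
  in $F$. This function has only removable singularities in the disc of radius $R$, so its Taylor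
  series converges at $r < R$ and has bounded terms there.
\<close>

lemma norm_apostol_bernoulli_plus_poles_le:
  assumes "l \<noteq> 0" "finite F" "F \<subseteq> apostol_bernoulli_poles l"
    and R: "\<And>a. a \<in> apostol_bernoulli_poles l - F \<Longrightarrow> R \<le> norm a"
    and "0 < r" "r < R"
  shows "\<exists>C. \<forall>n. norm (apostol_bernoulli n 0 l / fact n + (\<Sum>a\<in>F. 1 / a ^ n)) \<le> C / r ^ n"
proof -
  define g where "g = apostol_bernoulli_gen 0 l"
  define G where "G z = g z - (\<Sum>a\<in>F. a / (z - a))" for z
  have pole: "l * exp a = 1" "a \<noteq> 0" if "a \<in> F" for a
    using that assms(3) exp_eq_inverse_iff_poles[OF assms(1), of a] by auto
  have "exp meromorphic_on (UNIV :: complex set)"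
    by (intro analytic_on_imp_meromorphic_on analytic_intros)
  then have "G meromorphic_on UNIV"
    unfolding G_def g_def apostol_bernoulli_gen_def by (intro meromorphic_intros) auto
  then have isol: "isolated_singularity_at G w" for w
    using meromorphic_on_isolated_singularity[OF meromorphic_on_subset[of G UNIV "{w}"]] by blast
  have lim: "\<exists>L. G \<midarrow>w\<rightarrow> L" if w: "norm w < R" for w
  proof (cases "w \<in> F")
    case True
    then obtain L where L: "(\<lambda>z. g z - w / (z - w)) \<midarrow>w\<rightarrow> L"
      unfolding g_def using apostol_bernoulli_gen_minus_principal_part_tendsto pole(1) by blast
    have "(\<lambda>z. \<Sum>a\<in>F - {w}. a / (z - a)) \<midarrow>w\<rightarrow> (\<Sum>a\<in>F - {w}. a / (w - a))"
      by (intro tendsto_intros) auto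
    from tendsto_diff[OF L this] have "G \<midarrow>w\<rightarrow> L - (\<Sum>a\<in>F - {w}. a / (w - a))"
      using assms(2) True unfolding G_def by (simp add: sum.remove algebra_simps)
    then show ?thesis by blast
  next
    case False
    have "\<exists>L. g \<midarrow>w\<rightarrow> L"
    proof (cases "w = 0")
      case True
      then show ?thesis unfolding g_def using apostol_bernoulli_gen_tendsto by blast
    next
      case nz: False
      have "w \<notin> apostol_bernoulli_poles l" using R[of w] False w by (meson DiffI not_le)
      then have "l * exp w \<noteq> 1" using exp_eq_inverse_iff_poles[OF assms(1), of w] nz by auto
      then have "g \<midarrow>w\<rightarrow> g w"
        unfolding g_def apostol_bernoulli_gen_def by (intro tendsto_intros) auto
      then show ?thesis by blast
    qed
    then obtain L where L: "g \<midarrow>w\<rightarrow> L" by blast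
    have "(\<lambda>z. \<Sum>a\<in>F. a / (z - a)) \<midarrow>w\<rightarrow> (\<Sum>a\<in>F. a / (w - a))"
      using False by (intro tendsto_intros) auto
    from tendsto_diff[OF L this] show ?thesis unfolding G_def by blast
  qed
  have hol: "remove_sings G holomorphic_on eball 0 (ereal R)"
  proof (intro analytic_imp_holomorphic)
    have "remove_sings G analytic_on {w}" if "w \<in> eball 0 (ereal R)" for w
      using lim[of w] isol that remove_sings_analytic_at[of G w] by auto
    then show "remove_sings G analytic_on eball 0 (ereal R)"
      by (subst analytic_on_analytic_at) auto
  qed
  define e where "e n = apostol_bernoulli n 0 l / fact n + (\<Sum>a\<in>F. 1 / a ^ n)" for n
  have "remove_sings G has_fps_expansion Abs_fps e"
  proof -
    have "(\<lambda>z. remove_sings g z - (\<Sum>a\<in>F. a / (z - a))) has_fps_expansion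
      (Abs_fps (\<lambda>n. apostol_bernoulli n 0 l / fact n) - (\<Sum>a\<in>F. Abs_fps (\<lambda>n. - (1 / a ^ n))))"
      unfolding g_def
      by (intro fps_expansion_intros apostol_bernoulli_gen_has_fps_expansion
          has_fps_expansion_divide_diff pole)
    moreover have "Abs_fps (\<lambda>n. apostol_bernoulli n 0 l / fact n) - (\<Sum>a\<in>F. Abs_fps (\<lambda>n. - (1 / a ^ n))) = Abs_fps e"
      by (rule fps_ext) (simp add: e_def fps_sum_nth sum_negf)
    moreover have "\<forall>\<^sub>F z in nhds 0. remove_sings G z = remove_sings g z - (\<Sum>a\<in>F. a / (z - a))"
    proof -
      have g0: "g \<midarrow>0\<rightarrow> remove_sings g 0"
        using apostol_bernoulli_gen_tendsto[of 0 l] remove_sings_eqI[OF apostol_bernoulli_gen_tendsto[of 0 l]]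
        unfolding g_def by simp
      have "(\<lambda>z. g z - (\<Sum>a\<in>F. a / (z - a))) \<midarrow>0\<rightarrow> remove_sings g 0 - (\<Sum>a\<in>F. a / (0 - a))"
        using pole(2) by (intro tendsto_diff g0 tendsto_intros) auto
      then have rs0: "remove_sings G 0 = remove_sings g 0 - (\<Sum>a\<in>F. a / (0 - a))"
        unfolding G_def by (rule remove_sings_eqI)
      have "\<forall>\<^sub>F z in at 0. remove_sings G z = G z"
        by (intro eventually_remove_sings_eq_at isol)
      moreover have "\<forall>\<^sub>F z in at 0. remove_sings g z = g z"
        unfolding g_def by (intro eventually_remove_sings_eq_at apostol_bernoulli_gen_isolated)
      ultimately have "\<forall>\<^sub>F z in at 0. remove_sings G z = remove_sings g z - (\<Sum>a\<in>F. a / (z - a))"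
        by eventually_elim (simp add: G_def)
      then show ?thesis
        unfolding eventually_nhds_conv_at using rs0 by simp
    qed
    ultimately show ?thesis by (subst has_fps_expansion_cong[OF _ refl]) auto
  qed
  from has_fps_expansion_imp_sums_complex[OF this hol, of "of_real r"]
  have "summable (\<lambda>n. e n * of_real r ^ n)"
    using assms(5,6) by (auto intro: sums_summable)
  then have "Bseq (\<lambda>n. e n * of_real r ^ n)"
    by (intro convergent_imp_Bseq) (auto simp: convergent_def dest: summable_LIMSEQ_zero)
  then obtain C where C: "\<forall>n. norm (e n * of_real r ^ n) \<le> C" by (rule BseqE)
  then have "norm (e n) \<le> C / r ^ n" for n
    using assms(5) by (simp add: norm_mult norm_power field_simps)
  then show ?thesis unfolding e_def by blast
qed

lemma innermost_poles:
  assumes "l \<noteq> 0" "finite F" "\<mu> = (LEAST r. r \<in> norm ` (apostol_bernoulli_poles l - F))"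
  defines "A \<equiv> {a \<in> apostol_bernoulli_poles l - F. norm a = \<mu>}"
  shows "0 < \<mu>" and "finite A" and "A \<noteq> {}"
    and "\<And>a. a \<in> apostol_bernoulli_poles l - (F \<union> A) \<Longrightarrow> \<mu> < norm a"
proof -
  note least = apostol_bernoulli_poles_Diff_has_least[OF assms(2,3)]
  show "A \<noteq> {}" using least(1) by (auto simp: A_def)
  moreover have "a \<noteq> 0" if "a \<in> apostol_bernoulli_poles l" for a
    using that exp_eq_inverse_iff_poles[OF assms(1), of a] by auto
  ultimately show "0 < \<mu>" by (auto simp: A_def)
  show "finite A"
    by (rule finite_subset[OF _ apostol_bernoulli_poles_locally_finite[of l \<mu>]]) (auto simp: A_def)
  show "\<mu> < norm a" if "a \<in> apostol_bernoulli_poles l - (F \<union> A)" for a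
  proof -
    have "\<mu> \<le> norm a" using least(2) that by blast
    moreover have "norm a \<noteq> \<mu>" using that by (auto simp: A_def)
    ultimately show ?thesis by simp
  qed
qed

section \<open>The error term\<close>

text \<open>
  Both facts come from moving further layers of poles into \<open>F\<close>: the bound from adding the poles \<open>A\<close>
  of modulus \<open>\<mu>\<close>, the non-constancy from adding also the poles \<open>B\<close> of the next larger modulus. Then
  the error decays faster than the contribution of the layer added last.
\<close>

lemma apostol_bernoulli_remainder_at_0:
  fixes l :: complex and F :: "complex set" and \<mu> :: real
  assumes "l \<noteq> 0" "finite F" "F \<subseteq> apostol_bernoulli_poles l"
    and \<mu>: "\<mu> = (LEAST r. r \<in> norm ` (apostol_bernoulli_poles l - F))"
  defines "e \<equiv> \<lambda>n. apostol_bernoulli n 0 l / fact n + (\<Sum>a\<in>F. 1 / a ^ n)"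
  shows "\<exists>C. \<forall>n. norm (e n) * \<mu> ^ n \<le> C"
    and "\<exists>n\<ge>2. norm (e n) * \<mu> ^ n \<noteq> c"
proof -
  define A where "A = {a \<in> apostol_bernoulli_poles l - F. norm a = \<mu>}"
  note A = innermost_poles[OF assms(1,2) \<mu>, folded A_def]
  define \<rho> where "\<rho> = (LEAST r. r \<in> norm ` (apostol_bernoulli_poles l - (F \<union> A)))"
  define B where "B = {a \<in> apostol_bernoulli_poles l - (F \<union> A). norm a = \<rho>}"
  have FA: "finite (F \<union> A)" using assms(2) A(2) by simp
  note B = innermost_poles[OF assms(1) FA \<rho>_def, folded B_def]
  define \<sigma> where "\<sigma> = (LEAST r. r \<in> norm ` (apostol_bernoulli_poles l - (F \<union> A \<union> B)))"
  have FAB: "finite (F \<union> A \<union> B)" using FA B(2) by simp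
  have "\<mu> < \<rho>" using A(4) B(3) by (auto simp: B_def)
  have "\<rho> < \<sigma>"
    using apostol_bernoulli_poles_Diff_has_least(1)[OF FAB \<sigma>_def] B(4) by auto
  have sub: "F \<union> A \<subseteq> apostol_bernoulli_poles l" "F \<union> A \<union> B \<subseteq> apostol_bernoulli_poles l"
    using assms(3) by (auto simp: A_def B_def)
  have disj: "F \<inter> A = {}" "(F \<union> A) \<inter> B = {}" by (auto simp: A_def B_def)
  have eA: "apostol_bernoulli n 0 l / fact n + (\<Sum>a\<in>F \<union> A. 1 / a ^ n) = e n + (\<Sum>a\<in>A. 1 / a ^ n)" for n
    using assms(2) A(2) disj(1) by (simp add: e_def sum.union_disjoint)
  have eAB: "apostol_bernoulli n 0 l / fact n + (\<Sum>a\<in>F \<union> A \<union> B. 1 / a ^ n)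
      = e n + (\<Sum>a\<in>A. 1 / a ^ n) + (\<Sum>b\<in>B. 1 / b ^ n)" for n
    using FA B(2) disj(2) eA[of n] by (simp add: sum.union_disjoint)
  have "\<exists>C. \<forall>n. norm (e n + (\<Sum>a\<in>A. 1 / a ^ n)) \<le> C / \<mu> ^ n"
    using norm_apostol_bernoulli_plus_poles_le[OF assms(1) FA sub(1), of \<rho> \<mu>]
      apostol_bernoulli_poles_Diff_has_least(2)[OF FA \<rho>_def] A(1) \<open>\<mu> < \<rho>\<close> unfolding eA by blast
  then obtain C where C: "\<And>n. norm (e n + (\<Sum>a\<in>A. 1 / a ^ n)) \<le> C / \<mu> ^ n" by blast
  have "norm (e n) * \<mu> ^ n \<le> C + card A" for n
  proof -
    have "norm (\<Sum>a\<in>A. 1 / a ^ n) \<le> (\<Sum>a\<in>A. 1 / \<mu> ^ n)"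
      by (intro order_trans[OF norm_sum] sum_mono) (auto simp: A_def norm_divide norm_power)
    then have "norm (e n) \<le> C / \<mu> ^ n + card A / \<mu> ^ n"
      using C[of n] norm_triangle_ineq4[of "e n + (\<Sum>a\<in>A. 1 / a ^ n)" "\<Sum>a\<in>A. 1 / a ^ n"] by simp
    then show ?thesis using A(1) by (simp add: field_simps)
  qed
  then show "\<exists>C. \<forall>n. norm (e n) * \<mu> ^ n \<le> C" by blast
  \<comment> \<open>Any radius strictly between the moduli of the second and the third layer works.\<close>
  define r where "r = (\<rho> + \<sigma>) / 2"
  have r: "\<rho> < r" "r < \<sigma>" using \<open>\<rho> < \<sigma>\<close> by (auto simp: r_def)
  have "\<exists>D. \<forall>n. norm (e n + (\<Sum>a\<in>A. 1 / a ^ n) + (\<Sum>b\<in>B. 1 / b ^ n)) \<le> D / r ^ n"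
    using norm_apostol_bernoulli_plus_poles_le[OF assms(1) FAB sub(2), of \<sigma> r]
      apostol_bernoulli_poles_Diff_has_least(2)[OF FAB \<sigma>_def] B(1) r unfolding eAB by fastforce
  then obtain D where
    "\<And>n. norm (e n + (\<Sum>a\<in>A. 1 / a ^ n) + (\<Sum>b\<in>B. 1 / b ^ n)) \<le> D / r ^ n" by blast
  then show "\<exists>n\<ge>2. norm (e n) * \<mu> ^ n \<noteq> c"
    using A(1-3) B(2,3) \<open>\<mu> < \<rho>\<close> r(1)
    by (intro two_layer_power_sum_norm_not_constant[of A \<mu> B \<rho> r e D]) (auto simp: A_def B_def)
qed

text \<open>
  Splitting each $e^{az}$ at the $n$-th Taylor polynomial, the polynomial part combines with
  \<open>apostol_bernoulli_Appell\<close> to a convolution of the errors at $0$ with $z^k/k!$. What remains are the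
  tails of the exponential series.
\<close>

lemma norm_apostol_bernoulli_plus_poles_le_exp_sums:
  fixes l :: complex and F :: "complex set" and \<mu> :: real
  assumes "finite F" and F: "\<And>a. a \<in> F \<Longrightarrow> a \<noteq> 0 \<and> norm a \<le> \<mu>" and "0 < \<mu>"
  defines "e \<equiv> \<lambda>n. apostol_bernoulli n 0 l / fact n + (\<Sum>a\<in>F. 1 / a ^ n)"
  shows "norm (apostol_bernoulli n z l / fact n + (\<Sum>a\<in>F. exp (a * z) / a ^ n)) \<le>
    ((\<Sum>k\<le>n. (norm (e (n - k)) * \<mu> ^ (n - k)) * (\<mu> * norm z) ^ k / fact k)
      + card F * (exp (\<mu> * norm z) - (\<Sum>k\<le>n. (\<mu> * norm z) ^ k / fact k))) / \<mu> ^ n"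
proof -
  have split: "apostol_bernoulli n z l / fact n + (\<Sum>a\<in>F. exp (a * z) / a ^ n) =
    (\<Sum>k\<le>n. z ^ k / fact k * e (n - k))
      + (\<Sum>a\<in>F. (exp (a * z) - (\<Sum>k\<le>n. (a * z) ^ k / fact k)) / a ^ n)"
  proof -
    have "(\<Sum>a\<in>F. (\<Sum>k\<le>n. (a * z) ^ k / fact k) / a ^ n)
        = (\<Sum>a\<in>F. \<Sum>k\<le>n. z ^ k / fact k * (1 / a ^ (n - k)))"
    proof (intro sum.cong refl)
      fix a assume a: "a \<in> F"
      have "(a * z) ^ k / fact k / a ^ n = z ^ k / fact k * (1 / a ^ (n - k))" if "k \<in> {..n}" for k
      proof -
        have "a ^ n = a ^ k * a ^ (n - k)" using that by (simp flip: power_add)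
        then show ?thesis using F[OF a] by (simp add: power_mult_distrib)
      qed
      then show "(\<Sum>k\<le>n. (a * z) ^ k / fact k) / a ^ n = (\<Sum>k\<le>n. z ^ k / fact k * (1 / a ^ (n - k)))"
        unfolding sum_divide_distrib by (intro sum.cong) auto
    qed
    also have "\<dots> = (\<Sum>k\<le>n. z ^ k / fact k * (\<Sum>a\<in>F. 1 / a ^ (n - k)))"
      by (subst sum.swap) (simp add: sum_distrib_left)
    finally have "(\<Sum>k\<le>n. z ^ k / fact k * e (n - k)) = apostol_bernoulli n z l / fact n
        + (\<Sum>a\<in>F. (\<Sum>k\<le>n. (a * z) ^ k / fact k) / a ^ n)"
      unfolding e_def distrib_left sum.distrib apostol_bernoulli_Appell[of n z l] by simp
    then show ?thesis
      by (simp only: diff_divide_distrib sum_subtractf) simp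
  qed
  have tri: "norm ((\<Sum>k\<le>n. z ^ k / fact k * e (n - k))
      + (\<Sum>a\<in>F. (exp (a * z) - (\<Sum>k\<le>n. (a * z) ^ k / fact k)) / a ^ n))
    \<le> (\<Sum>k\<le>n. norm (z ^ k / fact k * e (n - k)))
      + (\<Sum>a\<in>F. norm ((exp (a * z) - (\<Sum>k\<le>n. (a * z) ^ k / fact k)) / a ^ n))"
    by (intro order_trans[OF norm_triangle_ineq] add_mono norm_sum)
  have conv: "(\<Sum>k\<le>n. norm (z ^ k / fact k * e (n - k)))
      = (\<Sum>k\<le>n. (norm (e (n - k)) * \<mu> ^ (n - k)) * (\<mu> * norm z) ^ k / fact k) / \<mu> ^ n"
    unfolding sum_divide_distrib
  proof (intro sum.cong refl)
    fix k assume "k \<in> {..n}"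
    then have "\<mu> ^ n = \<mu> ^ k * \<mu> ^ (n - k)" by (simp flip: power_add)
    then show "norm (z ^ k / fact k * e (n - k))
        = (norm (e (n - k)) * \<mu> ^ (n - k)) * (\<mu> * norm z) ^ k / fact k / \<mu> ^ n"
      using \<open>0 < \<mu>\<close> by (simp add: norm_mult norm_divide norm_power power_mult_distrib)
  qed
  have tails: "(\<Sum>a\<in>F. norm ((exp (a * z) - (\<Sum>k\<le>n. (a * z) ^ k / fact k)) / a ^ n))
      \<le> (\<Sum>a\<in>F. (exp (\<mu> * norm z) - (\<Sum>k\<le>n. (\<mu> * norm z) ^ k / fact k)) / \<mu> ^ n)"
    using F by (intro sum_mono norm_exp_remainder_div_power_le) auto
  show ?thesis
    using add_left_mono[OF tails] order_trans[OF tri] unfolding split conv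
    by (simp add: add_divide_distrib)
qed

theorem theorem3:
  fixes l :: complex and F K :: "complex set" and \<mu> :: real
  assumes "l \<noteq> 0"
    and "finite F" and "F \<subseteq> apostol_bernoulli_poles l"
    and "\<mu> = (LEAST r. r \<in> norm ` (apostol_bernoulli_poles l - F))"
    and "\<forall>a\<in>F. norm a < \<mu>"
    and "compact K"
  shows "(\<exists>C. \<forall>n\<ge>2. \<forall>z\<in>K.
            norm (apostol_bernoulli n z l / fact n + (\<Sum>a\<in>F. exp (a * z) / a ^ n))
              \<le> C * (exp (\<mu> * norm z) / \<mu> ^ n)) \<and>
         (\<forall>c. (\<forall>n\<ge>2. norm (apostol_bernoulli n 0 l / fact n + (\<Sum>a\<in>F. 1 / a ^ n)) \<le> c / \<mu> ^ n)
            \<longrightarrow> (\<exists>N. \<forall>n\<ge>N. \<forall>z\<in>K.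
                  norm (apostol_bernoulli n z l / fact n + (\<Sum>a\<in>F. exp (a * z) / a ^ n))
                    \<le> c * (exp (\<mu> * norm z) / \<mu> ^ n)))"
proof (intro conjI allI impI)
  define e where "e n = apostol_bernoulli n 0 l / fact n + (\<Sum>a\<in>F. 1 / a ^ n)" for n
  define E where "E n = norm (e n) * \<mu> ^ n" for n
  define S where "S n z = (\<Sum>k\<le>n. (\<mu> * norm z) ^ k / fact k)" for n and z :: complex
  have "0 < \<mu>" using innermost_poles(1)[OF assms(1,2,4)] .
  have F: "a \<noteq> 0 \<and> norm a \<le> \<mu>" if "a \<in> F" for a
    using that assms(3,5) exp_eq_inverse_iff_poles[OF assms(1), of a] by force
  have main: "norm (apostol_bernoulli n z l / fact n + (\<Sum>a\<in>F. exp (a * z) / a ^ n)) \<le>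
      ((\<Sum>k\<le>n. E (n - k) * (\<mu> * norm z) ^ k / fact k) + card F * (exp (\<mu> * norm z) - S n z)) / \<mu> ^ n"
    for n z
    unfolding E_def e_def S_def
    using norm_apostol_bernoulli_plus_poles_le_exp_sums[OF assms(2) F \<open>0 < \<mu>\<close>, where l = l and n = n and z = z] by simp
  have S: "S n z \<le> exp (\<mu> * norm z)" "0 \<le> S n z" for n z
    unfolding S_def using \<open>0 < \<mu>\<close> by (auto intro!: partial_sum_le_exp sum_nonneg)
  note rem = apostol_bernoulli_remainder_at_0[OF assms(1-4), folded e_def, folded E_def]

  show "\<exists>C. \<forall>n\<ge>2. \<forall>z\<in>K. norm (apostol_bernoulli n z l / fact n + (\<Sum>a\<in>F. exp (a * z) / a ^ n))
      \<le> C * (exp (\<mu> * norm z) / \<mu> ^ n)"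
  proof -
    obtain C where C: "\<And>n. E n \<le> C" using rem(1) by blast
    have "0 \<le> E 0" by (simp add: E_def)
    then have "0 \<le> C" using C[of 0] by linarith
    have "norm (apostol_bernoulli n z l / fact n + (\<Sum>a\<in>F. exp (a * z) / a ^ n))
        \<le> (C + card F) * (exp (\<mu> * norm z) / \<mu> ^ n)" for n z
    proof -
      have "(\<Sum>k\<le>n. E (n - k) * (\<mu> * norm z) ^ k / fact k) \<le> (\<Sum>k\<le>n. C * (\<mu> * norm z) ^ k / fact k)"
        using \<open>0 < \<mu>\<close> C by (intro sum_mono divide_right_mono mult_right_mono) auto
      also have "\<dots> = C * S n z" by (simp add: S_def sum_distrib_left)
      also have "\<dots> \<le> C * exp (\<mu> * norm z)" using S \<open>0 \<le> C\<close> by (intro mult_left_mono)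
      finally have "(\<Sum>k\<le>n. E (n - k) * (\<mu> * norm z) ^ k / fact k) + card F * (exp (\<mu> * norm z) - S n z)
          \<le> C * exp (\<mu> * norm z) + card F * exp (\<mu> * norm z)"
        using S by (intro add_mono mult_left_mono) auto
      also have "\<dots> = (C + card F) * exp (\<mu> * norm z)" by (simp add: distrib_right)
      finally have "((\<Sum>k\<le>n. E (n - k) * (\<mu> * norm z) ^ k / fact k) + card F * (exp (\<mu> * norm z) - S n z)) / \<mu> ^ n
          \<le> (C + card F) * exp (\<mu> * norm z) / \<mu> ^ n"
        using \<open>0 < \<mu>\<close> by (intro divide_right_mono) auto
      with main[of n z] show ?thesis by simp
    qed
    then show ?thesis by blast
  qed

  fix c :: real
  assume c: "\<forall>n\<ge>2. norm (apostol_bernoulli n 0 l / fact n + (\<Sum>a\<in>F. 1 / a ^ n)) \<le> c / \<mu> ^ n"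
  have Ec: "E n \<le> c" if "n \<ge> 2" for n
    using c that \<open>0 < \<mu>\<close> unfolding E_def e_def by (simp add: pos_le_divide_eq)
  obtain p where "p \<ge> 2" "E p \<noteq> c" using rem(2)[of c] by blast
  with Ec have "E p < c" by fastforce
  obtain M where M: "\<And>z. z \<in> K \<Longrightarrow> norm z \<le> M" "M > 0"
    using compact_imp_bounded[OF assms(6)] unfolding bounded_pos by blast
  obtain N where N: "\<And>n x. n \<ge> N \<Longrightarrow> 0 \<le> x \<Longrightarrow> x \<le> \<mu> * M \<Longrightarrow>
      (\<Sum>k\<le>n. E (n - k) * x ^ k / fact k) + card F * (exp x - (\<Sum>k\<le>n. x ^ k / fact k)) \<le> c * exp x"
    using exp_convolution_le_eventually[of "\<mu> * M" E c p "card F"] Ec \<open>p \<ge> 2\<close> \<open>E p < c\<close> \<open>0 < \<mu>\<close> \<open>M > 0\<close>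
    by auto
  have "norm (apostol_bernoulli n z l / fact n + (\<Sum>a\<in>F. exp (a * z) / a ^ n))
      \<le> c * (exp (\<mu> * norm z) / \<mu> ^ n)" if "n \<ge> N" "z \<in> K" for n z
  proof -
    have "(\<Sum>k\<le>n. E (n - k) * (\<mu> * norm z) ^ k / fact k) + card F * (exp (\<mu> * norm z) - S n z)
        \<le> c * exp (\<mu> * norm z)"
      unfolding S_def using \<open>0 < \<mu>\<close> M(1)[OF that(2)] by (intro N that(1)) auto
    then have "((\<Sum>k\<le>n. E (n - k) * (\<mu> * norm z) ^ k / fact k) + card F * (exp (\<mu> * norm z) - S n z)) / \<mu> ^ n
        \<le> c * exp (\<mu> * norm z) / \<mu> ^ n"
      using \<open>0 < \<mu>\<close> by (intro divide_right_mono) auto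
    with main[of n z] show ?thesis by simp
  qed
  then show "\<exists>N. \<forall>n\<ge>N. \<forall>z\<in>K.
      norm (apostol_bernoulli n z l / fact n + (\<Sum>a\<in>F. exp (a * z) / a ^ n))
        \<le> c * (exp (\<mu> * norm z) / \<mu> ^ n)"
    by blast
qed

end
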